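(* For every value of $-1<\rho<1$ there is a non-degenerate $L_2$-stationary random field $(X_k)_{k\in\mathbb{Z}}$ of square-integrable real random variables, with $E(X_k)=0$, $E(X_k^2)=1$ and $\mathrm{corr}(X_0,X_1)=\rho$, such that $X_k$ has the same distribution as $X_0$ for all $k\in\mathbb{Z}$, which has linear regressions $$E(X_k\mid X_{k-1},X_{k+1})=\alpha(X_{k-1}+X_{k+1})$$ and quadratic second moments $$E(X_k^2\mid X_{k-1},X_{k+1})=\alpha^2(X_{k-1}+X_{k+1})^2+C$$ for all $k\in\mathbb{Z}$, with some real constants $\alpha, C$, and such that (i) the conclusion "$\mathrm{corr}(X_0,X_k)=\rho^{|k|}$ for all $k\in\mathbb{Z}$" fails; (ii) the following conclusion, consisting of three statements about the distribution $\mathcal{L}(X_0)$ in terms of the parameter $R$, fails (that is, the three statements (a), (b), (c) do not all hold): (a) if $0\le R<2$, then $\mathcal{L}(X_0)$ is the uniquely determined symmetric distribution $\mu_{\rho,R}$ supported on a finite interval, and when $R=0$, $X_0=\pm c$ has two values; (b) if $R=2$, then $\mathcal{L}(X_0)$ is normal; (c) if $R>2$, then $\mathcal{L}(X_0)$ is not determined by moments.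
   Context: $L_2$-stationary means that the variables are square-integrable, $E(X_k)$ does not depend on $k$, and $E(X_kX_{k+j})$ does not depend on $k$ for each $j$. Equalities of conditional expectations hold almost surely. For a quadratic form $A(x^2+y^2)+Bxy+C+D(x+y)$ giving the conditional second moment, the parameter $R$ is defined for $\rho\neq 0$ by $R=B(\rho+1/\rho)^2$; for the form $\alpha^2(x+y)^2+C$ this means $A=\alpha^2$, $B=2\alpha^2$, $D=0$, so $R=2\alpha^2(\rho+1/\rho)^2$. For $0<|\rho|<1$ and $0\le R<2$, put $q=\frac{\rho^4+R-1}{1+\rho^4(R-1)}\in[-1,1)$; then $\mu_{\rho,R}$ is the unique probability measure on $\mathbb{R}$ with respect to which the polynomials given by $Q_{-1}=0$, $Q_0=1$, $xQ_n(x)=Q_{n+1}(x)+(1+q+\dots+q^{n-1})Q_{n-1}(x)$ are orthogonal; it is symmetric with bounded support, and is the two-point law on $\pm1$ when $R=0$. A distribution is not determined by moments if a different probability measure on $\mathbb{R}$ has the same moments of all orders. Statement (ii) refers to $\rho\ne 0$, where $R$ is defined. *)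

theory Defs
  imports "HOL-Probability.Probability" "HOL-Computational_Algebra.Polynomial"
begin

definition L2_stationary :: "'a measure \<Rightarrow> (int \<Rightarrow> 'a \<Rightarrow> real) \<Rightarrow> bool" where
  "L2_stationary M X \<longleftrightarrow>
     (\<forall>k. X k \<in> borel_measurable M \<and> integrable M (\<lambda>\<omega>. (X k \<omega>)\<^sup>2)) \<and>
     (\<forall>k l. (\<integral>\<omega>. X k \<omega> \<partial>M) = (\<integral>\<omega>. X l \<omega> \<partial>M)) \<and>
     (\<forall>j k l. (\<integral>\<omega>. X k \<omega> * X (k + j) \<omega> \<partial>M) = (\<integral>\<omega>. X l \<omega> * X (l + j) \<omega> \<partial>M))"

text \<open>Non-degeneracy of the field: finitely many of the variables are never linearly dependent
  almost surely. For a centred field this says that all its finite-dimensional covariance matrices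
  are nonsingular; in particular no single variable is almost surely constant.\<close>

definition nondegenerate_field :: "'a measure \<Rightarrow> (int \<Rightarrow> 'a \<Rightarrow> real) \<Rightarrow> bool" where
  "nondegenerate_field M X \<longleftrightarrow>
     (\<forall>I c. finite I \<longrightarrow> (AE \<omega> in M. (\<Sum>k\<in>I. c k * X k \<omega>) = 0) \<longrightarrow> (\<forall>k\<in>I. c k = (0::real)))"

definition corr :: "'a measure \<Rightarrow> ('a \<Rightarrow> real) \<Rightarrow> ('a \<Rightarrow> real) \<Rightarrow> real" where
  "corr M Y Z =
     (\<integral>\<omega>. (Y \<omega> - (\<integral>\<omega>'. Y \<omega>' \<partial>M)) * (Z \<omega> - (\<integral>\<omega>'. Z \<omega>' \<partial>M)) \<partial>M) /
     (sqrt (\<integral>\<omega>. (Y \<omega> - (\<integral>\<omega>'. Y \<omega>' \<partial>M))\<^sup>2 \<partial>M) *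
      sqrt (\<integral>\<omega>. (Z \<omega> - (\<integral>\<omega>'. Z \<omega>' \<partial>M))\<^sup>2 \<partial>M))"

text \<open>The conditional expectation of \<open>Z\<close> given the pair \<open>Y\<^sub>1, Y\<^sub>2\<close>, that is, given the
  sigma-algebra generated by that pair.\<close>

definition cond_exp_pair ::
  "'a measure \<Rightarrow> ('a \<Rightarrow> real) \<Rightarrow> ('a \<Rightarrow> real) \<Rightarrow> ('a \<Rightarrow> real) \<Rightarrow> 'a \<Rightarrow> real" where
  "cond_exp_pair M Y\<^sub>1 Y\<^sub>2 Z =
     real_cond_exp M
       (vimage_algebra (space M) (\<lambda>\<omega>. (Y\<^sub>1 \<omega>, Y\<^sub>2 \<omega>)) (borel :: (real \<times> real) measure)) Z"

definition R_param :: "real \<Rightarrow> real \<Rightarrow> real" where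
  "R_param \<rho> \<alpha> = 2 * \<alpha>\<^sup>2 * (\<rho> + 1 / \<rho>)\<^sup>2"

definition q_param :: "real \<Rightarrow> real \<Rightarrow> real" where
  "q_param \<rho> R = (\<rho> ^ 4 + R - 1) / (1 + \<rho> ^ 4 * (R - 1))"

fun Q_poly :: "real \<Rightarrow> nat \<Rightarrow> real poly" where
  "Q_poly q 0 = 1"
| "Q_poly q (Suc 0) = [:0, 1:]"
| "Q_poly q (Suc (Suc n)) =
     [:0, 1:] * Q_poly q (Suc n) - smult (\<Sum>i<Suc n. q ^ i) (Q_poly q n)"

text \<open>\<open>is_mu \<rho> R \<mu>\<close> says that \<open>\<mu>\<close> is the measure \<open>\<mu>\<^bsub>\<rho>,R\<^esub>\<close>: it is the probability measure
  making the polynomials \<open>Q\<^sub>n\<close> orthogonal. For \<open>0 < \<bar>\<rho>\<bar> < 1\<close> and \<open>0 \<le> R < 2\<close> there is exactly one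
  such measure, and its symmetry and bounded support are consequences rather than part of the
  definition. Orthogonality does not include positivity of the norms: for \<open>R = 0\<close> one has
  \<open>q = -1\<close>, and \<open>Q\<^sub>n\<close> vanishes almost everywhere for \<open>n \<ge> 2\<close>.\<close>

definition is_mu :: "real \<Rightarrow> real \<Rightarrow> real measure \<Rightarrow> bool" where
  "is_mu \<rho> R \<mu> \<longleftrightarrow> prob_space \<mu> \<and> sets \<mu> = sets borel \<and>
     (\<forall>m n. m \<noteq> n \<longrightarrow>
        integrable \<mu> (\<lambda>x. poly (Q_poly (q_param \<rho> R) m) x * poly (Q_poly (q_param \<rho> R) n) x) \<and>
        (\<integral>x. poly (Q_poly (q_param \<rho> R) m) x * poly (Q_poly (q_param \<rho> R) n) x \<partial>\<mu>) = 0)"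

definition normal_law :: "real measure \<Rightarrow> bool" where
  "normal_law \<mu> \<longleftrightarrow> (\<exists>m \<sigma>. \<sigma> > 0 \<and> \<mu> = density lborel (normal_density m \<sigma>))"

definition not_moment_determined :: "real measure \<Rightarrow> bool" where
  "not_moment_determined \<mu> \<longleftrightarrow>
     (\<exists>\<nu>. prob_space \<nu> \<and> sets \<nu> = sets borel \<and> \<nu> \<noteq> \<mu> \<and>
        (\<forall>n::nat. integrable \<mu> (\<lambda>x. x ^ n) \<and> integrable \<nu> (\<lambda>x. x ^ n) \<and>
           (\<integral>x. x ^ n \<partial>\<nu>) = (\<integral>x. x ^ n \<partial>\<mu>)))"

end

theory Submission
  imports Defs
begin

text \<open>The regression hypotheses constrain \<open>X\<^sub>k\<close> only through its two neighbours, that is, through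
  the law of three consecutive variables. For a centred stationary Gaussian field they hold automatically: the
  residual of \<open>X\<^sub>k\<close> after linear regression on \<open>X\<^sub>k\<^sub>-\<^sub>1\<close> and \<open>X\<^sub>k\<^sub>+\<^sub>1\<close> is independent of these
  two variables, so the regression is linear and the conditional variance is constant. The lag-two
  correlation \<open>r\<^sub>2\<close> remains free, and any value other than \<open>\<rho>\<^sup>2\<close> refutes the geometric decay. The
  regression coefficient is \<open>\<alpha> = \<rho> / (1 + r\<^sub>2)\<close>, hence \<open>R = 2 ((1 + \<rho>\<^sup>2) / (1 + r\<^sub>2))\<^sup>2\<close>. If \<open>r\<^sub>2 > \<rho>\<^sup>2\<close>
  then \<open>R < 2\<close>, so that statement (a) would require \<open>X\<^sub>0\<close> to have the law \<open>\<mu>\<close> with \<open>q < 1\<close> and fourth moment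
  \<open>2 + q\<close>, while the normal law has fourth moment 3.

  A field with \<open>r\<^sub>2 = \<bar>\<rho>\<bar> > \<rho>\<^sup>2\<close> is obtained by observing one common standard normal signal with
  independent noise, \<open>X\<^sub>k = sqrt \<bar>\<rho>\<bar> * sgn(\<rho>)^k * x + sqrt (1 - \<bar>\<rho>\<bar>) * z\<^sub>k\<close>; for \<open>\<rho> = 0\<close> the even and the odd
  times get two independent signals, which makes \<open>r\<^sub>1 = 0\<close> and \<open>r\<^sub>2 \<noteq> 0\<close>. The noise makes the field
  nondegenerate.

  The independence of the residual is the only analytic point. It follows from the invariance of
  the standard normal law on the plane under rotations (\<open>distr_normal_pair_rotate\<close>): two such
  rotations turn the signal and the noises of three consecutive times into four independent
  standard normal variables, two of which determine the neighbours while the other two determine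
  the residual (\<open>residual_indep\<close>). Independence of the residual yields both conditional moments by
  \<open>cond_exp_pair_linear_quadratic\<close>.\<close>

section \<open>Rotation invariance of the standard normal law on the plane\<close>

lemma std_normal_moments:
  "integrable std_normal_distribution (\<lambda>x. x ^ n)"
  "(\<integral>x. x \<partial>std_normal_distribution) = 0"
  "(\<integral>x. x\<^sup>2 \<partial>std_normal_distribution) = 1"
  "(\<integral>x. x ^ 4 \<partial>std_normal_distribution) = 3"
  using integrable_std_normal_distribution_moment[of n] std_normal_distribution_even_moments(1)[of 1]
    integral_std_normal_distribution_moment_odd[of 1] std_normal_distribution_even_moments(1)[of 2]
  by (simp_all add: fact_numeral)

text \<open>Two one-dimensional affine substitutions do it: first \<open>v = (t - c u) / s\<close> at fixed \<open>u\<close>, then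
  \<open>u = c t - s w\<close> at fixed \<open>t\<close>. Their factors \<open>1 / \<bar>s\<bar>\<close> and \<open>\<bar>s\<bar>\<close> cancel.\<close>

lemma nn_integral_lborel_rotate:
  fixes f :: "real \<times> real \<Rightarrow> ennreal" and c s :: real
  assumes f [measurable]: "f \<in> borel_measurable borel" and s: "s \<noteq> 0" and cs: "c\<^sup>2 + s\<^sup>2 = 1"
  shows "(\<integral>\<^sup>+u. \<integral>\<^sup>+v. f (u, v) \<partial>lborel \<partial>lborel) =
    (\<integral>\<^sup>+t. \<integral>\<^sup>+w. f (c * t - s * w, s * t + c * w) \<partial>lborel \<partial>lborel)"
proof -
  have f' [measurable]: "f \<in> borel_measurable (borel \<Otimes>\<^sub>M borel)" using f by (simp add: borel_prod)
  have line: "- (c * (c * t + - s * w)) / s + 1 / s * t = s * t + c * w" for t w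
  proof -
    have "- (c * (c * t + - s * w)) + t = (1 - c\<^sup>2) * t + c * s * w" by (simp add: algebra_simps power2_eq_square)
    also have "1 - c\<^sup>2 = s\<^sup>2" using cs by simp
    finally show ?thesis using s by (simp add: field_simps power2_eq_square)
  qed
  have "(\<integral>\<^sup>+u. \<integral>\<^sup>+v. f (u, v) \<partial>lborel \<partial>lborel) =
      (\<integral>\<^sup>+u. \<bar>1 / s\<bar> * (\<integral>\<^sup>+t. f (u, - (c * u) / s + 1 / s * t) \<partial>lborel) \<partial>lborel)"
    using s by (intro nn_integral_cong nn_integral_real_affine) auto
  also have "\<dots> = \<bar>1 / s\<bar> * (\<integral>\<^sup>+u. \<integral>\<^sup>+t. f (u, - (c * u) / s + 1 / s * t) \<partial>lborel \<partial>lborel)"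
    by (intro nn_integral_cmult) measurable
  also have "(\<integral>\<^sup>+u. \<integral>\<^sup>+t. f (u, - (c * u) / s + 1 / s * t) \<partial>lborel \<partial>lborel)
      = (\<integral>\<^sup>+t. \<integral>\<^sup>+u. f (u, - (c * u) / s + 1 / s * t) \<partial>lborel \<partial>lborel)"
    by (rule lborel_pair.Fubini') measurable
  also have "\<dots> = (\<integral>\<^sup>+t. \<bar>- s\<bar> *
      (\<integral>\<^sup>+w. f (c * t + - s * w, - (c * (c * t + - s * w)) / s + 1 / s * t) \<partial>lborel) \<partial>lborel)"
    using s by (intro nn_integral_cong nn_integral_real_affine) auto
  also have "\<dots> = \<bar>- s\<bar> *
      (\<integral>\<^sup>+t. \<integral>\<^sup>+w. f (c * t + - s * w, - (c * (c * t + - s * w)) / s + 1 / s * t) \<partial>lborel \<partial>lborel)"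
    by (intro nn_integral_cmult) measurable
  also have "\<bar>1 / s\<bar> * (\<bar>- s\<bar> *
      (\<integral>\<^sup>+t. \<integral>\<^sup>+w. f (c * t + - s * w, - (c * (c * t + - s * w)) / s + 1 / s * t) \<partial>lborel \<partial>lborel))
      = (\<integral>\<^sup>+t. \<integral>\<^sup>+w. f (c * t - s * w, s * t + c * w) \<partial>lborel \<partial>lborel)"
    using s unfolding line by (simp add: mult.assoc[symmetric] ennreal_mult'[symmetric])
  finally show ?thesis .
qed

abbreviation "N2 \<equiv> std_normal_distribution \<Otimes>\<^sub>M std_normal_distribution"

lemma prob_space_std_normal: "prob_space std_normal_distribution"
  using real_dist_normal_dist by (simp add: real_distribution_def)

lemma prob_space_N2: "prob_space N2"
  using prob_space_std_normal by (rule prob_space_pair) (rule prob_space_std_normal)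

lemma sets_N2: "sets N2 = sets (borel \<Otimes>\<^sub>M borel)"
  by (intro sets_pair_measure_cong) auto

text \<open>Lebesgue measure is invariant under the rotation, and the density of \<open>N2\<close> depends only on
  \<open>x\<^sup>2 + y\<^sup>2\<close>.\<close>

lemma distr_normal_pair_rotate:
  fixes c s :: real
  assumes "s \<noteq> 0" and cs: "c\<^sup>2 + s\<^sup>2 = 1"
  shows "distr N2 (borel \<Otimes>\<^sub>M borel) (\<lambda>(x, y). (c * x + s * y, - s * x + c * y)) = N2"
proof (rule measure_eqI)
  interpret N: prob_space std_normal_distribution by (rule prob_space_std_normal)
  let ?\<phi> = "std_normal_density"
  show "sets (distr N2 (borel \<Otimes>\<^sub>M borel) (\<lambda>(x, y). (c * x + s * y, - s * x + c * y))) = sets N2"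
    by (simp add: sets_N2)
  have nn_integral_N2: "(\<integral>\<^sup>+z. g z \<partial>N2) = (\<integral>\<^sup>+x. \<integral>\<^sup>+y. ?\<phi> x * ?\<phi> y * g (x, y) \<partial>lborel \<partial>lborel)"
    if g: "g \<in> borel_measurable (borel \<Otimes>\<^sub>M borel)" for g :: "real \<times> real \<Rightarrow> ennreal"
  proof -
    note [measurable] = g
    have "(\<integral>\<^sup>+z. g z \<partial>N2) = (\<integral>\<^sup>+x. \<integral>\<^sup>+y. g (x, y) \<partial>std_normal_distribution \<partial>std_normal_distribution)"
      by (intro N.nn_integral_fst[symmetric]) (simp add: sets_N2 cong: measurable_cong_sets)
    also have "\<dots> = (\<integral>\<^sup>+x. ?\<phi> x * (\<integral>\<^sup>+y. ?\<phi> y * g (x, y) \<partial>lborel) \<partial>lborel)"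
      by (simp add: nn_integral_density)
    also have "\<dots> = (\<integral>\<^sup>+x. \<integral>\<^sup>+y. ?\<phi> x * ?\<phi> y * g (x, y) \<partial>lborel \<partial>lborel)"
      by (simp add: nn_integral_cmult[symmetric] ennreal_mult' mult.assoc)
    finally show ?thesis .
  qed
  have radial: "?\<phi> (c * x - s * y) * ?\<phi> (s * x + c * y) = ?\<phi> x * ?\<phi> y" for x y
  proof -
    have "(c * x - s * y)\<^sup>2 + (s * x + c * y)\<^sup>2 = (c\<^sup>2 + s\<^sup>2) * (x\<^sup>2 + y\<^sup>2)"
      by (simp add: algebra_simps power2_eq_square)
    then show ?thesis
      using cs by (simp add: std_normal_density_def exp_add[symmetric] add_divide_distrib[symmetric] ac_simps)
  qed
  fix A assume "A \<in> sets (distr N2 (borel \<Otimes>\<^sub>M borel) (\<lambda>(x, y). (c * x + s * y, - s * x + c * y)))"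
  then have A [measurable]: "A \<in> sets (borel \<Otimes>\<^sub>M borel)" by simp
  let ?g = "\<lambda>z. indicator A (c * fst z + s * snd z, - s * fst z + c * snd z) :: ennreal"
  have unrotate: "c * (c * t - s * w) + s * (s * t + c * w) = t"
    "- s * (c * t - s * w) + c * (s * t + c * w) = w" for t w
  proof -
    have "c * (c * t - s * w) + s * (s * t + c * w) = (c\<^sup>2 + s\<^sup>2) * t"
      "- s * (c * t - s * w) + c * (s * t + c * w) = (c\<^sup>2 + s\<^sup>2) * w"
      by (simp_all add: algebra_simps power2_eq_square)
    then show "c * (c * t - s * w) + s * (s * t + c * w) = t"
      "- s * (c * t - s * w) + c * (s * t + c * w) = w" using cs by simp_all
  qed
  have "emeasure (distr N2 (borel \<Otimes>\<^sub>M borel) (\<lambda>(x, y). (c * x + s * y, - s * x + c * y))) A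
      = (\<integral>\<^sup>+z. indicator A z \<partial>distr N2 (borel \<Otimes>\<^sub>M borel) (\<lambda>(x, y). (c * x + s * y, - s * x + c * y)))"
    by simp
  also have "\<dots> = (\<integral>\<^sup>+z. ?g z \<partial>N2)"
    by (subst nn_integral_distr) (auto simp: case_prod_beta' sets_N2 cong: measurable_cong_sets)
  also have "\<dots> = (\<integral>\<^sup>+x. \<integral>\<^sup>+y. ?\<phi> x * ?\<phi> y * ?g (x, y) \<partial>lborel \<partial>lborel)"
    by (intro nn_integral_N2) measurable
  also have "\<dots> = (\<integral>\<^sup>+x. \<integral>\<^sup>+y. (\<lambda>(x, y). ?\<phi> x * ?\<phi> y * ?g (x, y)) (x, y) \<partial>lborel \<partial>lborel)"
    by simp
  also have "\<dots> = (\<integral>\<^sup>+t. \<integral>\<^sup>+w. (\<lambda>(x, y). ?\<phi> x * ?\<phi> y * ?g (x, y)) (c * t - s * w, s * t + c * w) \<partial>lborel \<partial>lborel)"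
    by (intro nn_integral_lborel_rotate assms) (simp add: borel_prod[symmetric])
  also have "\<dots> = (\<integral>\<^sup>+t. \<integral>\<^sup>+w. ?\<phi> t * ?\<phi> w * (indicator A (t, w) :: ennreal) \<partial>lborel \<partial>lborel)"
    by (simp only: prod.case fst_conv snd_conv unrotate radial)
  also have "\<dots> = emeasure N2 A"
    by (subst nn_integral_N2[symmetric]) (auto simp: sets_N2)
  finally show "emeasure (distr N2 (borel \<Otimes>\<^sub>M borel) (\<lambda>(x, y). (c * x + s * y, - s * x + c * y))) A = emeasure N2 A" .
qed

section \<open>Conditioning on a pair that is independent of the residual\<close>

text \<open>Independence as factorisation of the joint law, so that the two variables may take values in
  different types: a real residual will be independent of a pair.\<close>
definition (in prob_space) indep_rvs ::
  "'b measure \<Rightarrow> ('a \<Rightarrow> 'b) \<Rightarrow> 'c measure \<Rightarrow> ('a \<Rightarrow> 'c) \<Rightarrow> bool" where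
  "indep_rvs S X T Y \<longleftrightarrow> random_variable S X \<and> random_variable T Y \<and>
     distr M (S \<Otimes>\<^sub>M T) (\<lambda>\<omega>. (X \<omega>, Y \<omega>)) = distr M S X \<Otimes>\<^sub>M distr M T Y"

lemma (in prob_space) indep_rvs_iff_indep_var: "indep_rvs S X T Y \<longleftrightarrow> indep_var S X T Y"
  unfolding indep_rvs_def indep_var_distribution_eq by auto

lemma (in prob_space) indep_rvs_rv:
  assumes "indep_rvs S X T Y"
  shows "random_variable S X" "random_variable T Y"
  using assms by (auto simp: indep_rvs_def)

lemma (in prob_space) indep_rvs_compose:
  assumes ind: "indep_rvs S X T Y"
    and f [measurable]: "f \<in> measurable S S'" and g [measurable]: "g \<in> measurable T T'"
  shows "indep_rvs S' (\<lambda>\<omega>. f (X \<omega>)) T' (\<lambda>\<omega>. g (Y \<omega>))"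
proof -
  note [measurable] = indep_rvs_rv[OF ind]
  have "prob_space (distr M T' (\<lambda>\<omega>. g (Y \<omega>)))" by (rule prob_space_distr) measurable
  then have sf: "sigma_finite_measure (distr (distr M T Y) T' g)"
    by (simp add: distr_distr comp_def prob_space_imp_sigma_finite)
  have "distr M S' (\<lambda>\<omega>. f (X \<omega>)) \<Otimes>\<^sub>M distr M T' (\<lambda>\<omega>. g (Y \<omega>))
      = distr (distr M S X) S' f \<Otimes>\<^sub>M distr (distr M T Y) T' g"
    by (simp add: distr_distr comp_def)
  also have "\<dots> = distr (distr M S X \<Otimes>\<^sub>M distr M T Y) (S' \<Otimes>\<^sub>M T') (\<lambda>(x, y). (f x, g y))"
    by (rule pair_measure_distr[OF _ _ sf]) simp_all
  also have "distr M S X \<Otimes>\<^sub>M distr M T Y = distr M (S \<Otimes>\<^sub>M T) (\<lambda>\<omega>. (X \<omega>, Y \<omega>))"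
    using ind by (simp add: indep_rvs_def)
  also have "distr \<dots> (S' \<Otimes>\<^sub>M T') (\<lambda>(x, y). (f x, g y)) = distr M (S' \<Otimes>\<^sub>M T') (\<lambda>\<omega>. (f (X \<omega>), g (Y \<omega>)))"
    by (simp add: distr_distr comp_def)
  finally show ?thesis unfolding indep_rvs_def by simp
qed

lemma (in prob_space) real_cond_exp_indep:
  fixes W :: "'a \<Rightarrow> real" and Y :: "'a \<Rightarrow> 'b"
  assumes ind: "indep_rvs S Y borel W" and W: "integrable M W"
  shows "AE \<omega> in M. real_cond_exp M (vimage_algebra (space M) Y S) W \<omega> = expectation W"
proof -
  note [measurable] = indep_rvs_rv[OF ind]
  let ?F = "vimage_algebra (space M) Y S"
  have Yspace: "Y \<in> space M \<rightarrow> space S"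
    using measurable_space[OF indep_rvs_rv(1)[OF ind]] by auto
  have sub: "subalgebra M ?F"
    unfolding subalgebra_def sets_vimage_algebra2[OF Yspace] by auto
  interpret finite_measure_subalgebra M ?F
    by unfold_locales (rule sub)
  show ?thesis
  proof (rule real_cond_exp_charact)
    fix A assume "A \<in> sets ?F"
    then obtain B where B [measurable]: "B \<in> sets S" and A: "A = Y -` B \<inter> space M"
      by (auto simp: sets_vimage_algebra2[OF Yspace])
    have A_sets [measurable]: "A \<in> sets M" unfolding A by measurable
    have "indep_var borel (\<lambda>\<omega>. indicator B (Y \<omega>) :: real) borel (\<lambda>\<omega>. W \<omega>)"
      unfolding indep_rvs_iff_indep_var[symmetric] by (rule indep_rvs_compose[OF ind]) auto
    moreover have "integrable M (\<lambda>\<omega>. indicator B (Y \<omega>) :: real)"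
      by (rule integrable_const_bound[of _ 1]) (auto simp: indicator_def)
    ultimately have "(\<integral>\<omega>. indicator B (Y \<omega>) * W \<omega> \<partial>M) = (\<integral>\<omega>. indicator B (Y \<omega>) \<partial>M) * expectation W"
      using W by (intro indep_var_lebesgue_integral)
    then have "(\<integral>\<omega>. indicator B (Y \<omega>) * W \<omega> \<partial>M) = (\<integral>\<omega>. indicator B (Y \<omega>) * expectation W \<partial>M)"
      by simp
    moreover have "(\<integral>\<omega>. indicator A \<omega> * f \<omega> \<partial>M) = (\<integral>\<omega>. indicator B (Y \<omega>) * f \<omega> \<partial>M)" for f :: "'a \<Rightarrow> real"
      by (intro Bochner_Integration.integral_cong) (auto simp: A indicator_def)
    ultimately show "(\<integral>\<omega>\<in>A. W \<omega> \<partial>M) = (\<integral>\<omega>\<in>A. expectation W \<partial>M)"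
      by (simp only: set_lebesgue_integral_def real_scaleR_def)
  qed (use W in auto)
qed

text \<open>If the residual \<open>W = X - S\<close> of the linear predictor \<open>S\<close> is independent of the pair and
  centred, then \<open>X\<^sup>2 = S\<^sup>2 + 2 S W + W\<^sup>2\<close> has conditional expectation \<open>S\<^sup>2 + 0 + E(W\<^sup>2)\<close>: the
  conditional variance is constant, which is where the quadratic form gets its shape
  \<open>\<alpha>\<^sup>2(x + y)\<^sup>2 + C\<close>.\<close>

lemma (in prob_space) cond_exp_pair_linear_quadratic:
  fixes X Y1 Y2 :: "'a \<Rightarrow> real" and \<alpha> :: real
  defines "W \<equiv> \<lambda>\<omega>. X \<omega> - \<alpha> * (Y1 \<omega> + Y2 \<omega>)"
  assumes ind: "indep_rvs (borel \<Otimes>\<^sub>M borel) (\<lambda>\<omega>. (Y1 \<omega>, Y2 \<omega>)) borel W"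
    and [measurable]: "X \<in> borel_measurable M" "Y1 \<in> borel_measurable M" "Y2 \<in> borel_measurable M"
    and X: "integrable M (\<lambda>\<omega>. (X \<omega>)\<^sup>2)"
    and Y: "integrable M (\<lambda>\<omega>. (Y1 \<omega>)\<^sup>2)" "integrable M (\<lambda>\<omega>. (Y2 \<omega>)\<^sup>2)"
    and EW: "expectation W = 0"
  shows "AE \<omega> in M. cond_exp_pair M Y1 Y2 X \<omega> = \<alpha> * (Y1 \<omega> + Y2 \<omega>)"
    and "AE \<omega> in M. cond_exp_pair M Y1 Y2 (\<lambda>\<omega>. (X \<omega>)\<^sup>2) \<omega>
      = \<alpha>\<^sup>2 * (Y1 \<omega> + Y2 \<omega>)\<^sup>2 + expectation (\<lambda>\<omega>. (W \<omega>)\<^sup>2)"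
proof -
  let ?Y = "\<lambda>\<omega>. (Y1 \<omega>, Y2 \<omega>)"
  let ?F = "vimage_algebra (space M) ?Y (borel :: (real \<times> real) measure)"
  have ind': "indep_rvs borel ?Y borel W" using ind by (simp add: borel_prod)
  have sub: "subalgebra M ?F"
    unfolding subalgebra_def by (auto simp: sets_vimage_algebra2 intro!: measurable_sets)
  interpret F: finite_measure_subalgebra M ?F
    by unfold_locales (rule sub)
  define S where "S = (\<lambda>\<omega>. \<alpha> * (Y1 \<omega> + Y2 \<omega>))"
  have W_meas [measurable]: "W \<in> borel_measurable M" unfolding W_def by measurable
  have Y_F: "?Y \<in> measurable ?F (borel \<Otimes>\<^sub>M borel)"
    unfolding borel_prod by (rule measurable_vimage_algebra1) auto
  have S_F [measurable]: "S \<in> borel_measurable ?F"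
    unfolding S_def using measurable_compose[OF Y_F measurable_fst] measurable_compose[OF Y_F measurable_snd]
    by simp
  have S_meas [measurable]: "S \<in> borel_measurable M" unfolding S_def by measurable
  have S2: "integrable M (\<lambda>\<omega>. (S \<omega>)\<^sup>2)"
  proof (rule Bochner_Integration.integrable_bound)
    show "integrable M (\<lambda>\<omega>. 2 * \<alpha>\<^sup>2 * ((Y1 \<omega>)\<^sup>2 + (Y2 \<omega>)\<^sup>2))" using Y by simp
    have "(\<alpha> * (x + y))\<^sup>2 \<le> 2 * \<alpha>\<^sup>2 * (x\<^sup>2 + y\<^sup>2)" for x y :: real
    proof -
      have "(x + y)\<^sup>2 \<le> 2 * (x\<^sup>2 + y\<^sup>2)" using sum_squares_bound[of x y] by (simp add: power2_sum)
      from mult_left_mono[OF this, of "\<alpha>\<^sup>2"] show ?thesis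
        unfolding power_mult_distrib by (simp add: algebra_simps)
    qed
    then show "AE \<omega> in M. norm ((S \<omega>)\<^sup>2) \<le> norm (2 * \<alpha>\<^sup>2 * ((Y1 \<omega>)\<^sup>2 + (Y2 \<omega>)\<^sup>2))"
      by (auto simp: S_def)
  qed measurable
  have X_eq: "X \<omega> = S \<omega> + W \<omega>" for \<omega> by (simp add: S_def W_def)
  have W_eq: "W \<omega> = X \<omega> - S \<omega>" for \<omega> by (simp add: S_def W_def)
  have W2: "integrable M (\<lambda>\<omega>. (W \<omega>)\<^sup>2)"
  proof (rule Bochner_Integration.integrable_bound)
    show "integrable M (\<lambda>\<omega>. 2 * ((X \<omega>)\<^sup>2 + (S \<omega>)\<^sup>2))" using X S2 by simp
    have "(x - y)\<^sup>2 \<le> 2 * (x\<^sup>2 + y\<^sup>2)" for x y :: real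
      using sum_squares_bound[of x "-y"] by (simp add: power2_diff)
    then show "AE \<omega> in M. norm ((W \<omega>)\<^sup>2) \<le> norm (2 * ((X \<omega>)\<^sup>2 + (S \<omega>)\<^sup>2))"
      by (simp add: W_eq)
  qed measurable
  have S1: "integrable M S" and W1: "integrable M W"
    using square_integrable_imp_integrable[OF S_meas S2] square_integrable_imp_integrable[OF W_meas W2] .
  have cW: "AE \<omega> in M. real_cond_exp M ?F W \<omega> = 0"
    using real_cond_exp_indep[OF ind' W1] EW by simp
  have "indep_rvs borel ?Y borel (\<lambda>\<omega>. (W \<omega>)\<^sup>2)"
    using indep_rvs_compose[OF ind', of "\<lambda>y. y" borel "\<lambda>x. x\<^sup>2" borel] by simp
  then have cW2: "AE \<omega> in M. real_cond_exp M ?F (\<lambda>\<omega>. (W \<omega>)\<^sup>2) \<omega> = expectation (\<lambda>\<omega>. (W \<omega>)\<^sup>2)"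
    using real_cond_exp_indep[of borel ?Y "\<lambda>\<omega>. (W \<omega>)\<^sup>2"] W2 by simp
  have "AE \<omega> in M. real_cond_exp M ?F S \<omega> = S \<omega>"
    by (rule F.real_cond_exp_F_meas[OF S1 S_F])
  with F.real_cond_exp_add[OF S1 W1] cW
  show "AE \<omega> in M. cond_exp_pair M Y1 Y2 X \<omega> = \<alpha> * (Y1 \<omega> + Y2 \<omega>)"
    unfolding cond_exp_pair_def X_eq[abs_def] by eventually_elim (simp add: S_def)
  have "(\<lambda>\<omega>. 2 * S \<omega>) \<in> borel_measurable ?F" by measurable
  moreover have SW: "integrable M (\<lambda>\<omega>. 2 * S \<omega> * W \<omega>)"
  proof (rule Bochner_Integration.integrable_bound)
    show "integrable M (\<lambda>\<omega>. (S \<omega>)\<^sup>2 + (W \<omega>)\<^sup>2)" using S2 W2 by simp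
    have "\<bar>2 * x * y\<bar> \<le> x\<^sup>2 + y\<^sup>2" for x y :: real
      using sum_squares_bound[of x y] sum_squares_bound[of x "-y"] by (auto simp: abs_if)
    then show "AE \<omega> in M. norm (2 * S \<omega> * W \<omega>) \<le> norm ((S \<omega>)\<^sup>2 + (W \<omega>)\<^sup>2)"
      by auto
  qed measurable
  ultimately have cSW: "AE \<omega> in M. real_cond_exp M ?F (\<lambda>\<omega>. 2 * S \<omega> * W \<omega>) \<omega> = 2 * S \<omega> * real_cond_exp M ?F W \<omega>"
    by (rule F.real_cond_exp_mult[OF _ W_meas])
  have X2_eq: "(X \<omega>)\<^sup>2 = (S \<omega>)\<^sup>2 + (2 * S \<omega> * W \<omega> + (W \<omega>)\<^sup>2)" for \<omega>
    by (simp add: X_eq power2_sum)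
  have "AE \<omega> in M. real_cond_exp M ?F (\<lambda>\<omega>. (S \<omega>)\<^sup>2) \<omega> = (S \<omega>)\<^sup>2"
    by (rule F.real_cond_exp_F_meas[OF S2]) measurable
  with F.real_cond_exp_add[OF S2 Bochner_Integration.integrable_add[OF SW W2]]
    F.real_cond_exp_add[OF SW W2] cSW cW cW2
  show "AE \<omega> in M. cond_exp_pair M Y1 Y2 (\<lambda>\<omega>. (X \<omega>)\<^sup>2) \<omega>
      = \<alpha>\<^sup>2 * (Y1 \<omega> + Y2 \<omega>)\<^sup>2 + expectation (\<lambda>\<omega>. (W \<omega>)\<^sup>2)"
    unfolding cond_exp_pair_def X2_eq[abs_def] by eventually_elim (simp add: S_def power_mult_distrib)
qed

section \<open>Four independent standard normal variables\<close>

text \<open>Four independent standard normal variables, grouped as a pair of pairs: a rotation then acts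
  on the first pair alone, and exchanging the two middle variables brings another couple of
  variables into the first pair. These two moves generate the orthogonal change of variables
  needed for the residual.\<close>
definition (in prob_space) std_normal_quad ::
  "('a \<Rightarrow> real) \<Rightarrow> ('a \<Rightarrow> real) \<Rightarrow> ('a \<Rightarrow> real) \<Rightarrow> ('a \<Rightarrow> real) \<Rightarrow> bool" where
  "std_normal_quad A B C D \<longleftrightarrow>
     (\<lambda>\<omega>. ((A \<omega>, B \<omega>), (C \<omega>, D \<omega>))) \<in> measurable M ((borel \<Otimes>\<^sub>M borel) \<Otimes>\<^sub>M (borel \<Otimes>\<^sub>M borel)) \<and>
     distr M ((borel \<Otimes>\<^sub>M borel) \<Otimes>\<^sub>M (borel \<Otimes>\<^sub>M borel)) (\<lambda>\<omega>. ((A \<omega>, B \<omega>), (C \<omega>, D \<omega>))) = N2 \<Otimes>\<^sub>M N2"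

context prob_space
begin

lemma std_normal_quad_indep_rvs:
  assumes "std_normal_quad A B C D"
  shows "indep_rvs (borel \<Otimes>\<^sub>M borel) (\<lambda>\<omega>. (A \<omega>, B \<omega>)) (borel \<Otimes>\<^sub>M borel) (\<lambda>\<omega>. (C \<omega>, D \<omega>))"
proof -
  let ?b2 = "borel \<Otimes>\<^sub>M borel :: (real \<times> real) measure"
  let ?V = "\<lambda>\<omega>. ((A \<omega>, B \<omega>), (C \<omega>, D \<omega>))"
  from assms have V: "?V \<in> measurable M (?b2 \<Otimes>\<^sub>M ?b2)" and law: "distr M (?b2 \<Otimes>\<^sub>M ?b2) ?V = N2 \<Otimes>\<^sub>M N2"
    by (auto simp: std_normal_quad_def)
  have AB: "(\<lambda>\<omega>. (A \<omega>, B \<omega>)) \<in> measurable M ?b2" and CD: "(\<lambda>\<omega>. (C \<omega>, D \<omega>)) \<in> measurable M ?b2"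
    using measurable_compose[OF V measurable_fst] measurable_compose[OF V measurable_snd] by simp_all
  interpret N2: prob_space N2 by (rule prob_space_N2)
  interpret NN: pair_prob_space N2 N2 ..
  have "distr M ?b2 (\<lambda>\<omega>. (A \<omega>, B \<omega>)) = distr (distr M (?b2 \<Otimes>\<^sub>M ?b2) ?V) ?b2 fst"
    by (subst distr_distr[OF measurable_fst V]) (simp add: comp_def)
  also have "\<dots> = distr (N2 \<Otimes>\<^sub>M N2) N2 fst"
    unfolding law by (intro distr_cong) (simp_all add: sets_N2)
  also have "\<dots> = N2" by (rule N2.distr_pair_fst)
  finally have 1: "distr M ?b2 (\<lambda>\<omega>. (A \<omega>, B \<omega>)) = N2" .
  have "distr M ?b2 (\<lambda>\<omega>. (C \<omega>, D \<omega>)) = distr (distr M (?b2 \<Otimes>\<^sub>M ?b2) ?V) ?b2 snd"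
    by (subst distr_distr[OF measurable_snd V]) (simp add: comp_def)
  also have "\<dots> = distr (N2 \<Otimes>\<^sub>M N2) N2 snd"
    unfolding law by (intro distr_cong) (simp_all add: sets_N2)
  also have "\<dots> = N2" 
    by (subst NN.distr_pair_swap, subst distr_distr) (auto simp: comp_def case_prod_beta' N2.distr_pair_fst)
  finally have 2: "distr M ?b2 (\<lambda>\<omega>. (C \<omega>, D \<omega>)) = N2" .
  show ?thesis unfolding indep_rvs_def 1 2 using AB CD law by simp
qed

lemma std_normal_quad_map:
  assumes q: "std_normal_quad A B C D"
    and f: "f \<in> measurable ((borel \<Otimes>\<^sub>M borel) \<Otimes>\<^sub>M (borel \<Otimes>\<^sub>M borel)) ((borel \<Otimes>\<^sub>M borel) \<Otimes>\<^sub>M (borel \<Otimes>\<^sub>M borel))"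
    and inv: "distr (N2 \<Otimes>\<^sub>M N2) ((borel \<Otimes>\<^sub>M borel) \<Otimes>\<^sub>M (borel \<Otimes>\<^sub>M borel)) f = N2 \<Otimes>\<^sub>M N2"
    and eq: "\<And>\<omega>. f ((A \<omega>, B \<omega>), (C \<omega>, D \<omega>)) = ((A' \<omega>, B' \<omega>), (C' \<omega>, D' \<omega>))"
  shows "std_normal_quad A' B' C' D'"
proof -
  let ?b4 = "(borel \<Otimes>\<^sub>M borel) \<Otimes>\<^sub>M (borel \<Otimes>\<^sub>M borel) :: ((real \<times> real) \<times> (real \<times> real)) measure"
  let ?V = "\<lambda>\<omega>. ((A \<omega>, B \<omega>), (C \<omega>, D \<omega>))"
  from q have V: "?V \<in> measurable M ?b4" and law: "distr M ?b4 ?V = N2 \<Otimes>\<^sub>M N2"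
    by (auto simp: std_normal_quad_def)
  have "distr (distr M ?b4 ?V) ?b4 f = N2 \<Otimes>\<^sub>M N2" unfolding law by (rule inv)
  then show ?thesis
    using measurable_compose[OF V f] distr_distr[OF f V]
    by (simp add: std_normal_quad_def eq comp_def)
qed

lemma std_normal_quad_rotate:
  fixes c s :: real
  assumes q: "std_normal_quad A B C D" and s: "s \<noteq> 0" and cs: "c\<^sup>2 + s\<^sup>2 = 1"
  shows "std_normal_quad (\<lambda>\<omega>. c * A \<omega> + s * B \<omega>) (\<lambda>\<omega>. - s * A \<omega> + c * B \<omega>) C D"
proof (rule std_normal_quad_map[OF q])
  let ?r = "\<lambda>(x, y). (c * x + s * y, - s * x + c * y)"
  let ?b2 = "borel \<Otimes>\<^sub>M borel :: (real \<times> real) measure"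
  have r: "?r \<in> measurable N2 ?b2"
    unfolding measurable_cong_sets[OF sets_N2 refl] by measurable
  have i: "(\<lambda>x. x) \<in> measurable N2 ?b2"
    unfolding measurable_cong_sets[OF sets_N2 refl] by measurable
  have di: "distr N2 ?b2 (\<lambda>x. x) = N2"
    using sets_N2 by (intro distr_id2) simp
  show "(\<lambda>(p, q). (?r p, q)) \<in> measurable (?b2 \<Otimes>\<^sub>M ?b2) (?b2 \<Otimes>\<^sub>M ?b2)"
    by measurable
  show "distr (N2 \<Otimes>\<^sub>M N2) (?b2 \<Otimes>\<^sub>M ?b2) (\<lambda>(p, q). (?r p, q)) = N2 \<Otimes>\<^sub>M N2"
    using pair_measure_distr[OF r i] prob_space_imp_sigma_finite[OF prob_space_N2]
    unfolding di distr_normal_pair_rotate[OF s cs] by simp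
qed simp

end

section \<open>White noise indexed by the integers\<close>

abbreviation white_noise :: "(int \<Rightarrow> real) measure" where
  "white_noise \<equiv> PiM UNIV (\<lambda>_. std_normal_distribution)"

interpretation wn: prob_space white_noise
  by (rule prob_space_PiM) (rule prob_space_std_normal)

lemma distr_white_noise_coordinate: "distr white_noise borel (\<lambda>\<omega>. \<omega> i) = std_normal_distribution"
proof -
  have "distr white_noise borel (\<lambda>\<omega>. \<omega> i) = distr white_noise std_normal_distribution (\<lambda>\<omega>. \<omega> i)"
    by (intro distr_cong) auto
  also have "\<dots> = std_normal_distribution"
    by (rule distr_PiM_component) (auto intro: prob_space_std_normal)
  finally show ?thesis .
qed

lemma measurable_white_noise_coordinate [measurable]:
  "(\<lambda>\<omega>. \<omega> i) \<in> borel_measurable white_noise"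
proof -
  have "(\<lambda>\<omega>. \<omega> i) \<in> measurable white_noise std_normal_distribution" by measurable
  then show ?thesis by simp
qed

lemma indep_rvs_white_noise:
  assumes "I \<inter> J = {}"
    and f: "f \<in> measurable (PiM I (\<lambda>_. borel :: real measure)) S" and g: "g \<in> measurable (PiM J (\<lambda>_. borel :: real measure)) T"
  shows "wn.indep_rvs S (\<lambda>\<omega>. f (restrict \<omega> I)) T (\<lambda>\<omega>. g (restrict \<omega> J))"
proof -
  have "wn.indep_vars (\<lambda>_. borel) (\<lambda>i \<omega>. \<omega> i) (UNIV :: int set)"
  proof (subst wn.indep_vars_iff_distr_eq_PiM')
    have "distr white_noise (PiM UNIV (\<lambda>_. borel)) (\<lambda>\<omega>. restrict \<omega> (UNIV :: int set)) = white_noise"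
      unfolding restrict_UNIV by (intro distr_id2 sets_PiM_cong) auto
    then show "distr white_noise (PiM UNIV (\<lambda>_. borel)) (\<lambda>\<omega>. \<lambda>i\<in>(UNIV :: int set). \<omega> i)
        = (\<Pi>\<^sub>M i\<in>UNIV. distr white_noise borel (\<lambda>\<omega>. \<omega> i))"
      by (simp add: distr_white_noise_coordinate)
  qed auto
  from wn.indep_var_restrict[OF this assms(1)]
  have "wn.indep_rvs (PiM I (\<lambda>_. borel)) (\<lambda>\<omega>. restrict \<omega> I) (PiM J (\<lambda>_. borel)) (\<lambda>\<omega>. restrict \<omega> J)"
    by (simp add: wn.indep_rvs_iff_indep_var)
  from wn.indep_rvs_compose[OF this f g] show ?thesis .
qed

lemma indep_rvs_white_noise_pair:
  assumes "i \<noteq> j"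
  shows "wn.indep_rvs borel (\<lambda>\<omega>. \<omega> i) borel (\<lambda>\<omega>. \<omega> j)"
  using indep_rvs_white_noise[of "{i}" "{j}" "\<lambda>\<omega>. \<omega> i" borel "\<lambda>\<omega>. \<omega> j" borel] assms by simp

lemma distr_white_noise_pair:
  assumes "i \<noteq> j"
  shows "distr white_noise (borel \<Otimes>\<^sub>M borel) (\<lambda>\<omega>. (\<omega> i, \<omega> j)) = N2"
  using indep_rvs_white_noise_pair[OF assms]
  by (simp add: wn.indep_rvs_def distr_white_noise_coordinate)

lemma std_normal_quad_white_noise:
  assumes "distinct [i, j, k, l]"
  shows "wn.std_normal_quad (\<lambda>\<omega>. \<omega> i) (\<lambda>\<omega>. \<omega> j) (\<lambda>\<omega>. \<omega> k) (\<lambda>\<omega>. \<omega> l)"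
proof -
  have "wn.indep_rvs (borel \<Otimes>\<^sub>M borel) (\<lambda>\<omega>. (\<omega> i, \<omega> j)) (borel \<Otimes>\<^sub>M borel) (\<lambda>\<omega>. (\<omega> k, \<omega> l))"
    using indep_rvs_white_noise[of "{i, j}" "{k, l}" "\<lambda>\<omega>. (\<omega> i, \<omega> j)" "borel \<Otimes>\<^sub>M borel" "\<lambda>\<omega>. (\<omega> k, \<omega> l)" "borel \<Otimes>\<^sub>M borel"]
      assms by simp
  then show ?thesis
    using assms by (simp add: wn.indep_rvs_def wn.std_normal_quad_def distr_white_noise_pair)
qed

text \<open>The exchange preserves \<open>N2 \<Otimes>\<^sub>M N2\<close> because both sides are laws of the same four coordinates of
  white noise, read in two different orders.\<close>

lemma (in prob_space) std_normal_quad_swap: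
  assumes q: "std_normal_quad A B C D"
  shows "std_normal_quad A C B D"
proof (rule std_normal_quad_map[OF q])
  let ?b4 = "(borel \<Otimes>\<^sub>M borel) \<Otimes>\<^sub>M (borel \<Otimes>\<^sub>M borel) :: ((real \<times> real) \<times> (real \<times> real)) measure"
  let ?f = "\<lambda>z. ((fst (fst z), fst (snd z)), (snd (fst z), snd (snd z)))"
  show f: "?f \<in> measurable ?b4 ?b4" by measurable
  have 1: "(\<lambda>\<omega>::int \<Rightarrow> real. ((\<omega> 0, \<omega> 1), (\<omega> 2, \<omega> 3))) \<in> measurable white_noise ?b4"
    and law1: "distr white_noise ?b4 (\<lambda>\<omega>. ((\<omega> 0, \<omega> 1), (\<omega> 2, \<omega> 3))) = N2 \<Otimes>\<^sub>M N2"
    using std_normal_quad_white_noise[of 0 1 2 3] by (auto simp: wn.std_normal_quad_def)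
  have "distr (N2 \<Otimes>\<^sub>M N2) ?b4 ?f = distr white_noise ?b4 (\<lambda>\<omega>. ((\<omega> 0, \<omega> 2), (\<omega> 1, \<omega> 3)))"
    unfolding law1[symmetric] distr_distr[OF f 1] by (simp add: comp_def)
  also have "\<dots> = N2 \<Otimes>\<^sub>M N2"
    using std_normal_quad_white_noise[of 0 2 1 3] by (auto simp: wn.std_normal_quad_def)
  finally show "distr (N2 \<Otimes>\<^sub>M N2) ?b4 ?f = N2 \<Otimes>\<^sub>M N2" .
qed simp

lemma white_noise_moments:
  "integrable white_noise (\<lambda>\<omega>. \<omega> i)" "(\<integral>\<omega>. \<omega> i \<partial>white_noise) = 0"
  "integrable white_noise (\<lambda>\<omega>. \<omega> i * \<omega> j)" "(\<integral>\<omega>. \<omega> i * \<omega> j \<partial>white_noise) = of_bool (i = j)"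
proof -
  have law: "integrable white_noise (\<lambda>\<omega>. g (\<omega> k)) \<longleftrightarrow> integrable std_normal_distribution g"
      "(\<integral>\<omega>. g (\<omega> k) \<partial>white_noise) = (\<integral>x. g x \<partial>std_normal_distribution)"
    if [measurable]: "g \<in> borel_measurable borel" for g :: "real \<Rightarrow> real" and k
    using integrable_distr_eq[OF measurable_white_noise_coordinate[of k] that]
      integral_distr[OF measurable_white_noise_coordinate[of k] that]
    by (simp_all add: distr_white_noise_coordinate)
  show 1: "integrable white_noise (\<lambda>\<omega>. \<omega> i)" for i
    using law(1)[of "\<lambda>x. x" i] std_normal_moments(1)[of 1] by simp
  show 2: "(\<integral>\<omega>. \<omega> i \<partial>white_noise) = 0" for i
    using law(2)[of "\<lambda>x. x" i] std_normal_moments(2) by simp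
  show "integrable white_noise (\<lambda>\<omega>. \<omega> i * \<omega> j)"
    "(\<integral>\<omega>. \<omega> i * \<omega> j \<partial>white_noise) = of_bool (i = j)"
  proof -
    have "integrable white_noise (\<lambda>\<omega>. \<omega> i * \<omega> j) \<and> (\<integral>\<omega>. \<omega> i * \<omega> j \<partial>white_noise) = of_bool (i = j)"
    proof (cases "i = j")
      case True
      then show ?thesis
        using law[of "\<lambda>x. x\<^sup>2" i] std_normal_moments(1)[of 2] std_normal_moments(3)
        by (simp add: power2_eq_square)
    next
      case False
      then have "wn.indep_var borel (\<lambda>\<omega>. \<omega> i) borel (\<lambda>\<omega>. \<omega> j)"
        using indep_rvs_white_noise_pair by (simp add: wn.indep_rvs_iff_indep_var)
      from wn.indep_var_integrable[OF this 1 1] wn.indep_var_lebesgue_integral[OF this 1 1] False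
      show ?thesis by (simp add: 2)
    qed
    then show "integrable white_noise (\<lambda>\<omega>. \<omega> i * \<omega> j)"
      "(\<integral>\<omega>. \<omega> i * \<omega> j \<partial>white_noise) = of_bool (i = j)" by auto
  qed
qed

text \<open>The combination is the first coordinate of a rotated standard normal pair.\<close>

lemma distr_white_noise_combination:
  fixes c s :: real
  assumes "i \<noteq> j" and s: "s \<noteq> 0" and cs: "c\<^sup>2 + s\<^sup>2 = 1"
  shows "distr white_noise borel (\<lambda>\<omega>. c * \<omega> i + s * \<omega> j) = std_normal_distribution"
proof -
  let ?b2 = "borel \<Otimes>\<^sub>M borel :: (real \<times> real) measure"
  let ?r = "\<lambda>(x, y). (c * x + s * y, - s * x + c * y)"
  interpret N: prob_space std_normal_distribution by (rule prob_space_std_normal)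
  have p: "(\<lambda>\<omega>. (\<omega> i, \<omega> j)) \<in> measurable white_noise ?b2" by measurable
  have r: "?r \<in> measurable ?b2 ?b2" by measurable
  have "distr white_noise ?b2 (\<lambda>\<omega>. ?r (\<omega> i, \<omega> j)) = distr N2 ?b2 ?r"
    unfolding distr_white_noise_pair[OF assms(1), symmetric] distr_distr[OF r p] by (simp add: comp_def)
  also have "\<dots> = N2" by (rule distr_normal_pair_rotate[OF s cs])
  finally have 1: "distr white_noise ?b2 (\<lambda>\<omega>. ?r (\<omega> i, \<omega> j)) = N2" .
  have "distr white_noise borel (\<lambda>\<omega>. c * \<omega> i + s * \<omega> j) = distr N2 borel fst"
    unfolding 1[symmetric] by (subst distr_distr) (auto simp: comp_def)
  also have "\<dots> = distr N2 std_normal_distribution fst"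
    by (intro distr_cong) auto
  also have "\<dots> = std_normal_distribution" by (rule N.distr_pair_fst)
  finally show ?thesis .
qed

section \<open>A common signal observed with independent noise\<close>

text \<open>The even coordinates of white noise carry the noise, one for each time; odd coordinates carry
  the signal. The sign \<open>s\<close> and the signal coordinate \<open>p\<close> depend only on the parity of the time, so
  the two neighbours of a time always share the same signal with the same sign.\<close>
locale signal_plus_noise =
  fixes a b :: real and s :: "bool \<Rightarrow> real" and p :: "bool \<Rightarrow> int"
  assumes ab: "a\<^sup>2 + b\<^sup>2 = 1" and a: "a \<noteq> 0" and b: "b \<noteq> 0"
    and s: "\<And>e. (s e)\<^sup>2 = 1" and p: "\<And>e. odd (p e)"
begin

definition X :: "int \<Rightarrow> (int \<Rightarrow> real) \<Rightarrow> real" where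
  "X k \<omega> = a * s (even k) * \<omega> (p (even k)) + b * \<omega> (2 * k)"

text \<open>The covariance of two members of the field at odd distance.\<close>
definition r :: real where
  "r = (if p True = p False then a\<^sup>2 * s True * s False else 0)"

lemma p_neq [simp]: "p e \<noteq> 2 * k" "2 * k \<noteq> p e"
  using p[of e] by (metis dvd_triv_left)+

lemma X_measurable [measurable]: "X k \<in> borel_measurable white_noise"
  unfolding X_def[abs_def] by measurable

lemma X_mean: "integrable white_noise (X k)" "(\<integral>\<omega>. X k \<omega> \<partial>white_noise) = 0"
  unfolding X_def[abs_def] by (simp_all add: white_noise_moments)

lemma X_cross_noise:
  "integrable white_noise (\<lambda>\<omega>. X k \<omega> * \<omega> i)"
  "(\<integral>\<omega>. X k \<omega> * \<omega> i \<partial>white_noise) = a * s (even k) * of_bool (p (even k) = i) + b * of_bool (2 * k = i)"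
proof -
  have "X k \<omega> * \<omega> i = a * s (even k) * (\<omega> (p (even k)) * \<omega> i) + b * (\<omega> (2 * k) * \<omega> i)" for \<omega>
    by (simp add: X_def algebra_simps)
  then show "integrable white_noise (\<lambda>\<omega>. X k \<omega> * \<omega> i)"
    "(\<integral>\<omega>. X k \<omega> * \<omega> i \<partial>white_noise) = a * s (even k) * of_bool (p (even k) = i) + b * of_bool (2 * k = i)"
    by (simp_all add: white_noise_moments)
qed

lemma X_covariance:
  "integrable white_noise (\<lambda>\<omega>. X k \<omega> * X l \<omega>)"
  "(\<integral>\<omega>. X k \<omega> * X l \<omega> \<partial>white_noise) = (if even (l - k) then a\<^sup>2 else r) + (if l = k then b\<^sup>2 else 0)"
proof -
  have eq: "X k \<omega> * X l \<omega> = a * s (even l) * (X k \<omega> * \<omega> (p (even l))) + b * (X k \<omega> * \<omega> (2 * l))" for \<omega>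
    by (simp add: X_def[of l] algebra_simps)
  show "integrable white_noise (\<lambda>\<omega>. X k \<omega> * X l \<omega>)"
    unfolding eq by (simp add: X_cross_noise)
  have "(\<integral>\<omega>. X k \<omega> * X l \<omega> \<partial>white_noise)
      = a * s (even l) * (a * s (even k) * of_bool (p (even k) = p (even l))) + b * (b * of_bool (k = l))"
    unfolding eq by (simp add: X_cross_noise)
  also have "\<dots> = (if even (l - k) then a\<^sup>2 else r) + (if l = k then b\<^sup>2 else 0)"
    using s[of True] s[of False]
    by (cases "even k"; cases "even l") (auto simp: r_def power2_eq_square algebra_simps)
  finally show "(\<integral>\<omega>. X k \<omega> * X l \<omega> \<partial>white_noise) = (if even (l - k) then a\<^sup>2 else r) + (if l = k then b\<^sup>2 else 0)" .
qed

lemma X_square: "integrable white_noise (\<lambda>\<omega>. (X k \<omega>)\<^sup>2)" "(\<integral>\<omega>. (X k \<omega>)\<^sup>2 \<partial>white_noise) = 1"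
  using X_covariance[of k k] ab by (simp_all add: power2_eq_square)

lemma X_corr: "corr white_noise (X k) (X l) = (if even (l - k) then a\<^sup>2 else r) + (if l = k then b\<^sup>2 else 0)"
  by (simp add: corr_def X_mean X_square X_covariance)

lemma X_distr: "distr white_noise borel (X k) = std_normal_distribution"
  unfolding X_def[abs_def]
  by (rule distr_white_noise_combination) (use s[of "even k"] ab b in \<open>auto simp: power_mult_distrib\<close>)

lemma X_stationary: "L2_stationary white_noise X"
  unfolding L2_stationary_def using X_square by (auto simp: X_mean X_covariance)

text \<open>The noise coordinate \<open>\<omega> (2 * j)\<close> is correlated with no member of the field other than
  \<open>X j\<close>, so testing a vanishing combination against it isolates the coefficient of \<open>X j\<close>.\<close>

lemma X_nondegenerate: "nondegenerate_field white_noise X"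
  unfolding nondegenerate_field_def
proof (intro allI impI ballI)
  fix I c j
  assume I: "finite I" and zero: "AE \<omega> in white_noise. (\<Sum>k\<in>I. c k * X k \<omega>) = 0" and j: "j \<in> I"
  have "(\<integral>\<omega>. (\<Sum>k\<in>I. c k * (X k \<omega> * \<omega> (2 * j))) \<partial>white_noise) = (\<Sum>k\<in>I. c k * (b * of_bool (k = j)))"
    by (simp add: X_cross_noise)
  also have "\<dots> = c j * b" using I j by (simp add: of_bool_def if_distrib cong: if_cong)
  also have "(\<integral>\<omega>. (\<Sum>k\<in>I. c k * (X k \<omega> * \<omega> (2 * j))) \<partial>white_noise)
      = (\<integral>\<omega>. (\<Sum>k\<in>I. c k * X k \<omega>) * \<omega> (2 * j) \<partial>white_noise)"
    by (simp add: sum_distrib_right mult.assoc)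
  also have "\<dots> = 0" using zero by (intro integral_eq_zero_AE) auto
  finally show "c j = 0" using b by simp
qed

text \<open>The regression coefficient: the solution of \<open>r = \<alpha> (1 + a\<^sup>2)\<close>, which makes the residual
  uncorrelated with both neighbours, as the neighbours have variance 1 and covariance \<open>a\<^sup>2\<close>.\<close>
definition \<alpha> :: real where "\<alpha> = r / (1 + a\<^sup>2)"

lemma one_plus_square_pos: "1 + a\<^sup>2 > 0" by (simp add: add_pos_nonneg)

text \<open>If the middle time has a signal of its own, it shares no coordinate with its neighbours and
  \<open>\<alpha> = 0\<close>. Otherwise let \<open>x\<close> be the common signal and \<open>z\<^sub>1, z\<^sub>2\<close> the noises of the
  neighbours. Rotating \<open>(z\<^sub>1, z\<^sub>2)\<close> by 45 degrees gives their normalised sum \<open>\<sigma>\<close> and difference \<open>\<delta>\<close>;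
  rotating \<open>(\<sigma>, x)\<close> so that the first axis points along the sum of the neighbours gives \<open>T\<close> and \<open>V\<close>.
  The neighbours are functions of \<open>(T, \<delta>)\<close> and the residual is a function of \<open>V\<close> and the noise
  of the middle time, and these two pairs are independent.\<close>

lemma residual_indep:
  "wn.indep_rvs (borel \<Otimes>\<^sub>M borel) (\<lambda>\<omega>. (X (k - 1) \<omega>, X (k + 1) \<omega>))
     borel (\<lambda>\<omega>. X k \<omega> - \<alpha> * (X (k - 1) \<omega> + X (k + 1) \<omega>))"
proof (cases "p True = p False")
  case False
  then have disj: "{p (odd k), 2 * (k - 1), 2 * (k + 1)} \<inter> {p (even k), 2 * k} = {}"
    using p_neq(1)[of _ "k - 1"] p_neq(1)[of _ "k + 1"] by (cases "even k") auto
  have "wn.indep_rvs (borel \<Otimes>\<^sub>M borel) (\<lambda>\<omega>. (X (k - 1) \<omega>, X (k + 1) \<omega>)) borel (X k)"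
    using indep_rvs_white_noise[OF disj,
        of "\<lambda>\<omega>. (a * s (odd k) * \<omega> (p (odd k)) + b * \<omega> (2 * (k - 1)), a * s (odd k) * \<omega> (p (odd k)) + b * \<omega> (2 * (k + 1)))"
          "borel \<Otimes>\<^sub>M borel" "\<lambda>\<omega>. a * s (even k) * \<omega> (p (even k)) + b * \<omega> (2 * k)" borel]
    by (simp add: X_def[abs_def])
  moreover have "\<alpha> = 0" using False by (simp add: \<alpha>_def r_def)
  ultimately show ?thesis by simp
next
  case True
  define c0 where "c0 = p True"
  have p_c0: "p e = c0" for e using True by (cases e) (auto simp: c0_def)
  have c0_neq: "c0 \<noteq> 2 * l" "2 * l \<noteq> c0" for l using p_neq(1)[of True l] by (auto simp: c0_def simp del: p_neq)
  define t u n where "t = s (odd k)" and "u = s (even k)" and "n = sqrt (1 + a\<^sup>2)"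
  have t2: "t\<^sup>2 = 1" using s by (simp add: t_def)
  then have t0: "t \<noteq> 0" by auto
  have n2: "n\<^sup>2 = 1 + a\<^sup>2" and n0: "n > 0" using one_plus_square_pos by (auto simp: n_def)
  have \<alpha>: "\<alpha> = a\<^sup>2 * t * u / n\<^sup>2"
    using True by (cases "even k") (auto simp: \<alpha>_def r_def t_def u_def n2)
  let ?h = "1 / sqrt 2 :: real"
  have h: "?h\<^sup>2 + ?h\<^sup>2 = 1" "?h \<noteq> 0" by (simp_all add: power_divide)
  define \<sigma> \<delta> where "\<sigma> \<omega> = ?h * \<omega> (2 * (k - 1)) + ?h * \<omega> (2 * (k + 1))"
    and "\<delta> \<omega> = - ?h * \<omega> (2 * (k - 1)) + ?h * \<omega> (2 * (k + 1))" for \<omega> :: "int \<Rightarrow> real"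
  have "wn.std_normal_quad (\<lambda>\<omega>. \<omega> (2 * (k - 1))) (\<lambda>\<omega>. \<omega> (2 * (k + 1))) (\<lambda>\<omega>. \<omega> c0) (\<lambda>\<omega>. \<omega> (2 * k))"
    using c0_neq(1)[of "k - 1"] c0_neq(1)[of "k + 1"] by (intro std_normal_quad_white_noise) (auto simp: c0_neq)
  from wn.std_normal_quad_swap[OF wn.std_normal_quad_rotate[OF this h(2) h(1)]]
  have q: "wn.std_normal_quad \<sigma> (\<lambda>\<omega>. \<omega> c0) \<delta> (\<lambda>\<omega>. \<omega> (2 * k))"
    by (simp add: \<sigma>_def[abs_def] \<delta>_def[abs_def])
  \<comment> \<open>The sum of the neighbours is \<open>sqrt 2 * (b * \<sigma> + sqrt 2 * a * t * x)\<close>; dividing the two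
    coefficients in the bracket by their Euclidean norm \<open>n\<close> gives the direction of \<open>T\<close>.\<close>
  let ?c = "b / n" and ?s = "sqrt 2 * a * t / n"
  have cs: "?c\<^sup>2 + ?s\<^sup>2 = 1"
  proof -
    have "?c\<^sup>2 + ?s\<^sup>2 = (b\<^sup>2 + 2 * a\<^sup>2) / n\<^sup>2"
      by (simp add: power_divide power_mult_distrib t2 add_divide_distrib)
    also have "b\<^sup>2 + 2 * a\<^sup>2 = n\<^sup>2" using ab n2 by simp
    finally show ?thesis using n0 by simp
  qed
  have s0: "?s \<noteq> 0" using a t0 n0 by simp
  define T V where "T \<omega> = ?c * \<sigma> \<omega> + ?s * \<omega> c0" and "V \<omega> = - ?s * \<sigma> \<omega> + ?c * \<omega> c0" for \<omega>
  have "wn.std_normal_quad T \<delta> V (\<lambda>\<omega>. \<omega> (2 * k))"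
    using wn.std_normal_quad_swap[OF wn.std_normal_quad_rotate[OF q s0 cs]]
    by (simp add: T_def[abs_def] V_def[abs_def])
  then have ind: "wn.indep_rvs (borel \<Otimes>\<^sub>M borel) (\<lambda>\<omega>. (T \<omega>, \<delta> \<omega>)) (borel \<Otimes>\<^sub>M borel) (\<lambda>\<omega>. (V \<omega>, \<omega> (2 * k)))"
    by (rule wn.std_normal_quad_indep_rvs)
  have nT: "n * T \<omega> = b * \<sigma> \<omega> + sqrt 2 * a * t * \<omega> c0" for \<omega>
    using n0 by (simp add: T_def field_simps)
  have \<sigma>: "sqrt 2 * \<sigma> \<omega> = \<omega> (2 * (k - 1)) + \<omega> (2 * (k + 1))"
    and \<delta>: "sqrt 2 * \<delta> \<omega> = \<omega> (2 * (k + 1)) - \<omega> (2 * (k - 1))" for \<omega>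
    by (simp_all add: \<sigma>_def \<delta>_def field_simps)
  have halve: "x = y / sqrt 2" if "sqrt 2 * y = 2 * x" for x y :: real
  proof -
    have "sqrt 2 * y = sqrt 2 * (sqrt 2 * x)" using that by (simp flip: mult.assoc)
    then show ?thesis by simp
  qed
  have X1: "X (k - 1) \<omega> = (n * T \<omega> - b * \<delta> \<omega>) / sqrt 2" for \<omega>
  proof -
    have "sqrt 2 * (n * T \<omega> - b * \<delta> \<omega>) = b * (sqrt 2 * \<sigma> \<omega>) - b * (sqrt 2 * \<delta> \<omega>) + 2 * a * t * \<omega> c0"
      unfolding nT by (simp add: algebra_simps)
    also have "\<dots> = 2 * X (k - 1) \<omega>"
      unfolding \<sigma> \<delta> by (simp add: X_def p_c0 t_def algebra_simps)
    finally show ?thesis by (rule halve)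
  qed
  have X2: "X (k + 1) \<omega> = (n * T \<omega> + b * \<delta> \<omega>) / sqrt 2" for \<omega>
  proof -
    have "sqrt 2 * (n * T \<omega> + b * \<delta> \<omega>) = b * (sqrt 2 * \<sigma> \<omega>) + b * (sqrt 2 * \<delta> \<omega>) + 2 * a * t * \<omega> c0"
      unfolding nT by (simp add: algebra_simps)
    also have "\<dots> = 2 * X (k + 1) \<omega>"
      unfolding \<sigma> \<delta> by (simp add: X_def p_c0 t_def algebra_simps)
    finally show ?thesis by (rule halve)
  qed
  have W: "X k \<omega> - \<alpha> * (X (k - 1) \<omega> + X (k + 1) \<omega>) = b * \<omega> (2 * k) + a * b * u / n * V \<omega>" for \<omega>
  proof -
    have sum: "X (k - 1) \<omega> + X (k + 1) \<omega> = 2 * a * t * \<omega> c0 + b * (sqrt 2 * \<sigma> \<omega>)"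
      unfolding \<sigma> by (simp add: X_def p_c0 t_def algebra_simps)
    have nV: "n * V \<omega> = b * \<omega> c0 - a * t * (sqrt 2 * \<sigma> \<omega>)"
      using n0 by (simp add: V_def field_simps)
    have x_coeff: "n\<^sup>2 - 2 * a\<^sup>2 * t\<^sup>2 = b\<^sup>2" using ab n2 t2 by simp
    have "n\<^sup>2 * (X k \<omega> - \<alpha> * (X (k - 1) \<omega> + X (k + 1) \<omega>))
        = n\<^sup>2 * b * \<omega> (2 * k) + a * u * (n\<^sup>2 - 2 * a\<^sup>2 * t\<^sup>2) * \<omega> c0 - a\<^sup>2 * t * u * b * (sqrt 2 * \<sigma> \<omega>)"
      unfolding sum \<alpha> using n0 by (simp add: X_def[of k] p_c0 u_def[symmetric] field_simps power2_eq_square)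
    also have "\<dots> = n\<^sup>2 * b * \<omega> (2 * k) + a * b * u * (n * V \<omega>)"
      unfolding x_coeff nV by (simp add: field_simps power2_eq_square)
    also have "\<dots> = n\<^sup>2 * (b * \<omega> (2 * k) + a * b * u / n * V \<omega>)"
      using n0 by (simp add: field_simps power2_eq_square)
    finally show ?thesis using n0 by (metis mult_cancel_left power_not_zero less_irrefl)
  qed
  show ?thesis
    unfolding W unfolding X1 X2
    using wn.indep_rvs_compose[OF ind, of "\<lambda>(x, y). ((n * x - b * y) / sqrt 2, (n * x + b * y) / sqrt 2)" "borel \<Otimes>\<^sub>M borel"
       "\<lambda>(v, z). b * z + a * b * u / n * v" borel] by simp
qed

lemma X_conditional_moments:
  "AE \<omega> in white_noise. cond_exp_pair white_noise (X (k - 1)) (X (k + 1)) (X k) \<omega>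
     = \<alpha> * (X (k - 1) \<omega> + X (k + 1) \<omega>)"
  "AE \<omega> in white_noise. cond_exp_pair white_noise (X (k - 1)) (X (k + 1)) (\<lambda>\<omega>. (X k \<omega>)\<^sup>2) \<omega>
     = \<alpha>\<^sup>2 * (X (k - 1) \<omega> + X (k + 1) \<omega>)\<^sup>2 + (1 - 2 * \<alpha> * r)"
proof -
  let ?W = "\<lambda>\<omega>. X k \<omega> - \<alpha> * (X (k - 1) \<omega> + X (k + 1) \<omega>)"
  have EW: "wn.expectation ?W = 0" by (simp add: X_mean)
  have "(?W \<omega>)\<^sup>2 = X k \<omega> * X k \<omega> - 2 * \<alpha> * (X k \<omega> * X (k - 1) \<omega>) - 2 * \<alpha> * (X k \<omega> * X (k + 1) \<omega>)
      + \<alpha>\<^sup>2 * (X (k - 1) \<omega> * X (k - 1) \<omega>) + 2 * \<alpha>\<^sup>2 * (X (k - 1) \<omega> * X (k + 1) \<omega>)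
      + \<alpha>\<^sup>2 * (X (k + 1) \<omega> * X (k + 1) \<omega>)" for \<omega>
    by (simp add: power2_eq_square algebra_simps)
  then have "wn.expectation (\<lambda>\<omega>. (?W \<omega>)\<^sup>2) = 1 - 4 * \<alpha> * r + 2 * \<alpha> * (\<alpha> * (1 + a\<^sup>2))"
    using ab by (simp add: X_covariance algebra_simps power2_eq_square)
  also have "\<alpha> * (1 + a\<^sup>2) = r" using one_plus_square_pos by (simp add: \<alpha>_def)
  finally have EW2: "wn.expectation (\<lambda>\<omega>. (?W \<omega>)\<^sup>2) = 1 - 2 * \<alpha> * r" by simp
  note * = wn.cond_exp_pair_linear_quadratic[OF residual_indep X_measurable X_measurable X_measurable
      X_square(1) X_square(1) X_square(1) EW]
  from *(1) show "AE \<omega> in white_noise. cond_exp_pair white_noise (X (k - 1)) (X (k + 1)) (X k) \<omega>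
     = \<alpha> * (X (k - 1) \<omega> + X (k + 1) \<omega>)" .
  from *(2) show "AE \<omega> in white_noise. cond_exp_pair white_noise (X (k - 1)) (X (k + 1)) (\<lambda>\<omega>. (X k \<omega>)\<^sup>2) \<omega>
     = \<alpha>\<^sup>2 * (X (k - 1) \<omega> + X (k + 1) \<omega>)\<^sup>2 + (1 - 2 * \<alpha> * r)"
    unfolding EW2 .
qed

end

section \<open>The counterexample\<close>

text \<open>Orthogonality of \<open>Q\<^sub>3 = x\<^sup>3 - (2 + q) x\<close> and \<open>Q\<^sub>1 = x\<close> forces \<open>E(x\<^sup>4) = (2 + q) E(x\<^sup>2)\<close>, whereas
  the standard normal law has \<open>E(x\<^sup>4) = 3 E(x\<^sup>2)\<close>.\<close>

lemma std_normal_not_is_mu: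
  assumes "is_mu \<rho> R std_normal_distribution"
  shows "q_param \<rho> R = 1"
proof -
  let ?q = "q_param \<rho> R" and ?Q = "Q_poly (q_param \<rho> R)"
  have "poly (?Q 3) x * poly (?Q 1) x = x ^ 4 - (2 + ?q) * x\<^sup>2" for x
    by (simp add: eval_nat_numeral algebra_simps)
  then have "(\<integral>x. poly (?Q 3) x * poly (?Q 1) x \<partial>std_normal_distribution) = 3 - (2 + ?q)"
    using std_normal_moments by simp
  moreover have "(\<integral>x. poly (?Q 3) x * poly (?Q 1) x \<partial>std_normal_distribution) = 0"
    using assms unfolding is_mu_def by (metis numeral_eq_one_iff semiring_norm(86))
  ultimately show ?thesis by simp
qed

lemma q_param_neq_1:
  assumes "\<bar>\<rho>\<bar> < 1" "0 \<le> R" "R < 2"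
  shows "q_param \<rho> R \<noteq> 1"
proof
  have p4: "\<rho> ^ 4 < 1" "0 \<le> \<rho> ^ 4"
    using power_less_one_iff[of "\<bar>\<rho>\<bar>" 4] assms(1) by auto
  assume "q_param \<rho> R = 1"
  moreover have "1 + \<rho> ^ 4 * (R - 1) > 0"
    using mult_left_mono[of "-1" "R - 1" "\<rho> ^ 4"] p4 assms by simp
  ultimately have "\<rho> ^ 4 + R - 1 = 1 + \<rho> ^ 4 * (R - 1)"
    by (simp add: q_param_def)
  then have "(1 - \<rho> ^ 4) * (R - 2) = 0" by (simp add: algebra_simps)
  with p4 assms show False by simp
qed

theorem theorem3p3:
  fixes \<rho> :: real
  assumes "-1 < \<rho>" and "\<rho> < 1"
  shows "\<exists>(M :: (int \<Rightarrow> real) measure) (X :: int \<Rightarrow> (int \<Rightarrow> real) \<Rightarrow> real) (\<alpha> :: real) (C :: real).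
    prob_space M \<and> L2_stationary M X \<and> nondegenerate_field M X \<and>
    (\<forall>k. (\<integral>\<omega>. X k \<omega> \<partial>M) = 0) \<and>
    (\<forall>k. (\<integral>\<omega>. (X k \<omega>)\<^sup>2 \<partial>M) = 1) \<and>
    corr M (X 0) (X 1) = \<rho> \<and>
    (\<forall>k. distr M borel (X k) = distr M borel (X 0)) \<and>
    (\<forall>k. AE \<omega> in M. cond_exp_pair M (X (k - 1)) (X (k + 1)) (X k) \<omega>
            = \<alpha> * (X (k - 1) \<omega> + X (k + 1) \<omega>)) \<and>
    (\<forall>k. AE \<omega> in M. cond_exp_pair M (X (k - 1)) (X (k + 1)) (\<lambda>\<omega>. (X k \<omega>)\<^sup>2) \<omega>
            = \<alpha>\<^sup>2 * (X (k - 1) \<omega> + X (k + 1) \<omega>)\<^sup>2 + C) \<and>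
    \<not> (\<forall>k. corr M (X 0) (X k) = \<rho> ^ nat \<bar>k\<bar>) \<and>
    (\<rho> \<noteq> 0 \<longrightarrow>
      \<not> ((0 \<le> R_param \<rho> \<alpha> \<and> R_param \<rho> \<alpha> < 2 \<longrightarrow>
             is_mu \<rho> (R_param \<rho> \<alpha>) (distr M borel (X 0)) \<and>
             (R_param \<rho> \<alpha> = 0 \<longrightarrow> (\<exists>c>0. AE \<omega> in M. X 0 \<omega> = c \<or> X 0 \<omega> = - c))) \<and>
         (R_param \<rho> \<alpha> = 2 \<longrightarrow> normal_law (distr M borel (X 0))) \<and>
         (R_param \<rho> \<alpha> > 2 \<longrightarrow> not_moment_determined (distr M borel (X 0)))))"
proof -
  \<comment> \<open>\<open>v\<close> is the variance of the scaled signal and the correlation at any nonzero even distance. For \<open>\<rho> \<noteq> 0\<close> one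
    signal serves all times, with alternating sign if \<open>\<rho> < 0\<close>; for \<open>\<rho> = 0\<close> the two parities have
    independent signals, and any \<open>v\<close> strictly between 0 and 1 would do.\<close>
  define v where "v = (if \<rho> = 0 then 1 / 2 else \<bar>\<rho>\<bar>)"
  define a b where "a = sqrt v" and "b = sqrt (1 - v)"
  define s where "s e = (if e \<or> \<rho> \<ge> 0 then 1 else - 1 :: real)" for e
  define p where "p e = (if e \<or> \<rho> \<noteq> 0 then 1 else - 1 :: int)" for e
  have v: "0 < v" "v < 1" using assms by (auto simp: v_def)
  have a2: "a\<^sup>2 = v" and b2: "b\<^sup>2 = 1 - v" using v by (simp_all add: a_def b_def)
  interpret signal_plus_noise a b s p
    by unfold_locales (use v in \<open>auto simp: a2 b2 a_def b_def s_def p_def\<close>)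
  have r: "r = \<rho>" by (auto simp: r_def a2 v_def s_def p_def)
  \<comment> \<open>The geometric decay already fails at distance 2.\<close>
  have "corr white_noise (X 0) (X 2) \<noteq> \<rho> ^ nat \<bar>2\<bar>"
  proof -
    have "corr white_noise (X 0) (X 2) = v" by (simp add: X_corr a2)
    moreover have "v \<noteq> \<rho>\<^sup>2"
    proof (cases "\<rho> = 0")
      case False
      then have "v * v < v * 1" using v by (intro mult_strict_left_mono) auto
      moreover have "\<rho>\<^sup>2 = v * v" using False by (simp add: v_def power2_eq_square flip: abs_mult)
      ultimately show ?thesis using v by simp
    qed (simp add: v_def)
    ultimately show ?thesis by simp
  qed
  then have not_i: "\<not> (\<forall>k. corr white_noise (X 0) (X k) = \<rho> ^ nat \<bar>k\<bar>)" by blast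
  have not_mu: "0 \<le> R_param \<rho> \<alpha> \<and> R_param \<rho> \<alpha> < 2 \<and> \<not> is_mu \<rho> (R_param \<rho> \<alpha>) (distr white_noise borel (X 0))"
    if "\<rho> \<noteq> 0"
  proof -
    have "\<alpha> = \<rho> / (1 + v)" by (simp add: \<alpha>_def r a2)
    moreover have "\<rho> * (\<rho> + 1 / \<rho>) = 1 + v\<^sup>2"
      using that by (simp add: v_def distrib_left power2_eq_square flip: abs_mult)
    ultimately have "\<alpha> * (\<rho> + 1 / \<rho>) = (1 + v\<^sup>2) / (1 + v)"
      by simp
    then have R: "R_param \<rho> \<alpha> = 2 * ((1 + v\<^sup>2) / (1 + v))\<^sup>2"
      unfolding R_param_def by (simp add: power_mult_distrib[symmetric])
    have "(1 + v\<^sup>2) / (1 + v) < 1" using v by (simp add: power2_eq_square)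
    moreover have "0 \<le> (1 + v\<^sup>2) / (1 + v)" using v by simp
    ultimately have "((1 + v\<^sup>2) / (1 + v))\<^sup>2 < 1" by (subst abs_square_less_1) (simp only: abs_of_nonneg)
    then have R_bounds: "0 \<le> R_param \<rho> \<alpha>" "R_param \<rho> \<alpha> < 2" by (simp_all add: R)
    then show ?thesis
      using std_normal_not_is_mu q_param_neq_1[of \<rho>] assms by (auto simp: X_distr abs_less_iff)
  qed
  show ?thesis
    by (rule exI[of _ white_noise], rule exI[of _ X], rule exI[of _ \<alpha>], rule exI[of _ "1 - 2 * \<alpha> * r"])
      (use X_stationary X_nondegenerate X_mean X_square X_conditional_moments not_i not_mu
        in \<open>auto simp: X_corr X_distr r wn.prob_space_axioms\<close>)
qed

end
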